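(* Let $f$ be an arithmetic function (a complex-valued function on the positive integers) and let $g(n) = \sum_{d \mid n} f(d)$ for every positive integer $n$. Then for every positive integer $n$ and every non-negative integer $a$, $$\sum_{d \mid (a,n)} f\left(\frac{n}{d}\right) d = \sum_{d \mid n} Ns(a,d)\, g\left(\frac{n}{d}\right),$$ where the sums are over positive divisors.
   Context: For a positive integer $n$ and a non-negative integer $a$, define $$Ns(a,n) = \varphi(n)\,\frac{\mu\left(\frac{n}{(a,n)}\right)}{\varphi\left(\frac{n}{(a,n)}\right)},$$ where $\varphi$ is the Euler function, $\mu$ is the M\"obius function and $(a,n)$ is the greatest common divisor of $a$ and $n$ (with $(0,n)=n$). *)

theory Defs
  imports Complex_Main "HOL-Number_Theory.Number_Theory"
    "HOL-Computational_Algebra.Squarefree"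
begin

(* 0 is not squarefree, so moebius_mu 0 = 0; only positive arguments are meaningful. *)
definition moebius_mu :: "nat \<Rightarrow> int" where
  "moebius_mu n = (if squarefree n then (-1) ^ card (prime_factors n) else 0)"

definition Ns :: "nat \<Rightarrow> nat \<Rightarrow> complex" where
  "Ns a n = of_nat (totient n) *
     (of_int (moebius_mu (n div gcd a n)) / of_nat (totient (n div gcd a n)))"

end

theory Submission
  imports Defs
begin

text \<open>
  The function \<open>Ns a\<close> is the Ramanujan sum \<open>c\<^sub>d(a)\<close> in Hoelder's closed form, and the identity
  expresses the fact that its divisor sum is the divisibility indicator
  \<open>(\<Sum>d | d dvd m. Ns a d) = (if m dvd a then m else 0)\<close>
  (\<open>sum_divisors_Ns\<close>). Granted this, inserting the definition of \<open>g\<close> into the right-hand side and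
  collecting the terms containing a fixed \<open>f e\<close> leaves \<open>f e\<close> times the divisor sum of \<open>Ns a\<close> at
  \<open>m = n div e\<close>; only those \<open>e\<close> survive for which \<open>m\<close> also divides \<open>a\<close>, and they contribute
  \<open>f (n div m) * m\<close>, which is the left-hand side.

  For the divisor sum, both sides are multiplicative in \<open>m\<close>, because \<open>Ns a\<close> is (\<open>Ns_mult_coprime\<close>).
  It remains to treat powers of a prime \<open>p\<close>. As long as \<open>p ^ k\<close> divides \<open>a\<close>, the value
  \<open>Ns a (p ^ k)\<close> is \<open>totient (p ^ k)\<close>, and the partial sums are \<open>1, p, p ^ 2, \<dots>\<close>. At the first
  \<open>p ^ k\<close> not dividing \<open>a\<close>, if there is one, the value is \<open>- p ^ (k - 1)\<close>, which cancels
  the sum accumulated so far; all later values vanish.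
\<close>

section \<open>Multiplicativity\<close>

lemma moebius_mu_mult_coprime:
  assumes "coprime x y"
  shows "moebius_mu (x * y) = moebius_mu x * moebius_mu y"
proof (cases "squarefree x \<and> squarefree y")
  case True
  then have "x \<noteq> 0" "y \<noteq> 0"
    by (metis not_squarefree_0)+
  moreover from this have "prime_factors x \<inter> prime_factors y = {}"
    using assms by (auto simp: in_prime_factors_iff dest: coprime_common_divisor_nat)
  ultimately have "card (prime_factors (x * y)) = card (prime_factors x) + card (prime_factors y)"
    by (simp add: prime_factors_product card_Un_disjoint)
  then show ?thesis
    using True squarefree_mult_coprime[OF assms] by (simp add: moebius_mu_def power_add)
next
  case False
  then show ?thesis
    using squarefree_multD[of x y] by (auto simp: moebius_mu_def)
qed

lemma gcd_mult_coprime_distrib: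
  fixes a x y :: nat
  assumes "coprime x y"
  shows "gcd a (x * y) = gcd a x * gcd a y"
proof (rule dvd_antisym)
  obtain b c where bc: "gcd a (x * y) = b * c" "b dvd x" "c dvd y"
    using division_decomp[of "gcd a (x * y)" x y] by auto
  moreover have "b dvd a" "c dvd a"
    using bc(1) by (metis gcd_dvd1 dvd_mult_left, metis gcd_dvd1 dvd_mult_right)
  ultimately show "gcd a (x * y) dvd gcd a x * gcd a y"
    by (simp add: mult_dvd_mono)
next
  have "coprime (gcd a x) (gcd a y)"
    using assms by (meson coprime_divisors gcd_dvd2)
  then show "gcd a x * gcd a y dvd gcd a (x * y)"
    by (intro gcd_greatest divides_mult) (auto intro: mult_dvd_mono)
qed

lemma Ns_mult_coprime:
  assumes "coprime x y"
  shows "Ns a (x * y) = Ns a x * Ns a y"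
proof -
  let ?q = "\<lambda>m. m div gcd a m"
  have q: "?q (x * y) = ?q x * ?q y"
    by (simp add: gcd_mult_coprime_distrib[OF assms] div_mult_div_if_dvd)
  have "?q x dvd x" "?q y dvd y"
    by (metis dvd_div_mult_self dvd_triv_left gcd_dvd2)+
  then have "coprime (?q x) (?q y)"
    using assms by (meson coprime_divisors)
  then show ?thesis
    by (simp add: Ns_def q moebius_mu_mult_coprime totient_mult_coprime assms)
qed

text \<open>
  Each divisor of a product of coprime numbers splits uniquely into divisors of the factors, which
  are recovered as its gcds with these factors; so the sum runs over a product set.
\<close>

lemma sum_divisors_mult_coprime:
  fixes h :: "nat \<Rightarrow> 'a::comm_semiring_0"
  assumes xy: "coprime x y"
    and h: "\<And>b c. coprime b c \<Longrightarrow> h (b * c) = h b * h c"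
  shows "(\<Sum>d | d dvd x * y. h d) = (\<Sum>d | d dvd x. h d) * (\<Sum>d | d dvd y. h d)"
proof -
  let ?D = "\<lambda>m::nat. {d. d dvd m}"
  have gcd: "gcd (b * c) x = b" "gcd (b * c) y = c" if "b dvd x" "c dvd y" for b c
  proof -
    have "coprime c x" "coprime b y"
      using that xy by (meson coprime_commute coprime_divisors dvd_refl)+
    moreover have "gcd b x = b" "gcd c y = c"
      using that by (simp_all add: gcd_nat.absorb1)
    ultimately show "gcd (b * c) x = b" "gcd (b * c) y = c"
      using gcd_mult_left_right_cancel[of x c b] gcd_mult_left_left_cancel[of y b c]
      by (simp_all add: coprime_commute)
  qed
  have inj: "inj_on (\<lambda>(b, c). b * c) (?D x \<times> ?D y)"
    using gcd by (intro inj_onI) (clarsimp, metis)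
  have image: "(\<lambda>(b, c). b * c) ` (?D x \<times> ?D y) = ?D (x * y)"
  proof (intro equalityI subsetI)
    fix d assume "d \<in> ?D (x * y)"
    then obtain b c where "d = b * c" "b dvd x" "c dvd y"
      using division_decomp[of d x y] by auto
    then show "d \<in> (\<lambda>(b, c). b * c) ` (?D x \<times> ?D y)"
      by auto
  qed (auto intro: mult_dvd_mono)
  have "(\<Sum>d | d dvd x * y. h d) = (\<Sum>(b, c)\<in>?D x \<times> ?D y. h (b * c))"
    using sum.reindex[OF inj, of h] unfolding image by (simp add: case_prod_unfold)
  also have "\<dots> = (\<Sum>(b, c)\<in>?D x \<times> ?D y. h b * h c)"
    using xy by (intro sum.cong) (auto intro!: h intro: coprime_divisors)
  finally show ?thesis
    by (simp add: sum_product sum.cartesian_product)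
qed

section \<open>The divisor sum of \<open>Ns a\<close>\<close>

lemma sum_divisors_prime_power:
  assumes "prime (p::nat)"
  shows "(\<Sum>d | d dvd p ^ k. h d) = (\<Sum>i\<le>k. h (p ^ i))"
proof -
  have "{d. d dvd p ^ k} = (\<lambda>i. p ^ i) ` {..k}"
    using divides_primepow_nat[OF assms] by auto
  moreover have "inj_on (\<lambda>i. p ^ i) {..k}"
    using prime_gt_1_nat[OF assms] by (auto intro: inj_onI)
  ultimately show ?thesis
    by (simp add: sum.reindex)
qed

text \<open>
  The three cases correspond to the quotient \<open>p ^ Suc k div gcd a (p ^ Suc k)\<close> being \<open>1\<close>,
  being \<open>p\<close>, or being divisible by \<open>p\<^sup>2\<close>.
\<close>

lemma Ns_prime_power_Suc:
  assumes p: "prime p"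
  shows "Ns a (p ^ Suc k) =
    (if p ^ Suc k dvd a then of_nat (p ^ Suc k) - of_nat (p ^ k)
     else if p ^ k dvd a then - of_nat (p ^ k) else 0)"
proof -
  have p1: "p > 1"
    using p by (rule prime_gt_1_nat)
  have tot: "of_nat (totient (p ^ Suc k)) = (of_nat (p ^ k) * (of_nat p - 1) :: complex)"
    using p1 by (simp add: totient_prime_power_Suc[OF p] of_nat_diff del: power_Suc)
  obtain j where j: "j \<le> Suc k" "gcd a (p ^ Suc k) = p ^ j"
    using divides_primepow_nat[OF p, of "gcd a (p ^ Suc k)" "Suc k"] gcd_dvd2 by blast
  have dvd_iff: "p ^ i dvd a \<longleftrightarrow> i \<le> j" if "i \<le> Suc k" for i
  proof -
    have "p ^ i dvd a \<longleftrightarrow> p ^ i dvd gcd a (p ^ Suc k)"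
      using that by (simp add: le_imp_power_dvd del: power_Suc)
    also have "\<dots> \<longleftrightarrow> i \<le> j"
      using p1 unfolding j(2) by (simp add: dvd_power_iff_le)
    finally show ?thesis .
  qed
  have quot: "p ^ Suc k div gcd a (p ^ Suc k) = p ^ (Suc k - j)"
    using j p1 by (simp add: power_diff del: power_Suc)
  consider "j = Suc k" | "j = k" | "j < k"
    using j(1) by linarith
  then show ?thesis
  proof cases
    case 1
    then have "Ns a (p ^ Suc k) = of_nat (totient (p ^ Suc k))"
      unfolding Ns_def quot by (simp add: moebius_mu_def del: power_Suc)
    moreover have "p ^ Suc k dvd a"
      using 1 dvd_iff by blast
    ultimately show ?thesis
      unfolding tot by (simp add: algebra_simps)
  next
    case 2
    have "moebius_mu p = -1"
      using p by (simp add: moebius_mu_def squarefree_prime prime_prime_factors)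
    then have "Ns a (p ^ Suc k) = of_nat (p ^ k) * (of_nat p - 1) * (- 1 / (of_nat p - 1))"
      using 2 p1 unfolding Ns_def quot tot by (simp add: totient_prime[OF p] of_nat_diff)
    also have "\<dots> = - of_nat (p ^ k)"
      using p1 by (simp add: field_simps)
    finally show ?thesis
      using 2 dvd_iff[of k] dvd_iff[of "Suc k"] by (simp del: power_Suc)
  next
    case 3
    then have "\<not> squarefree (p ^ (Suc k - j))"
      using p1 by (auto simp: squarefree_power_iff)
    then have "Ns a (p ^ Suc k) = 0"
      unfolding Ns_def quot by (simp add: moebius_mu_def)
    then show ?thesis
      using 3 dvd_iff[of k] dvd_iff[of "Suc k"] by (simp del: power_Suc)
  qed
qed

lemma Ns_1: "Ns a 1 = 1"
  by (simp add: Ns_def moebius_mu_def)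

lemma sum_Ns_prime_powers:
  assumes "prime p"
  shows "(\<Sum>i\<le>k. Ns a (p ^ i)) = (if p ^ k dvd a then of_nat (p ^ k) else 0)"
proof (induction k)
  case 0
  show ?case
    using Ns_1 by simp
next
  case (Suc k)
  have "p ^ k dvd a" if "p ^ Suc k dvd a"
    using that by (metis dvd_mult_right power_Suc)
  then show ?case
    by (simp add: Suc Ns_prime_power_Suc[OF assms] del: power_Suc)
qed

lemma sum_divisors_Ns:
  assumes "m > 0"
  shows "(\<Sum>d | d dvd m. Ns a d) = (if m dvd a then of_nat m else 0)"
  using assms
proof (induction m rule: less_induct)
  case (less m)
  show ?case
  proof (cases "m = 1")
    case True
    then show ?thesis
      using Ns_1 by simp
  next
    case False
    then obtain p where p: "prime p" "p dvd m"
      using prime_factor_nat by blast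
    define k where "k = multiplicity p m"
    have "m \<noteq> 0" "\<not> is_unit p"
      using less.prems p(1) by (auto simp: not_prime_unit)
    from multiplicity_decompose'[OF this]
    obtain y where y: "m = p ^ k * y" "\<not> p dvd y"
      unfolding k_def .
    have coprime: "coprime (p ^ k) y"
      using p(1) y(2) by (simp add: prime_imp_coprime)
    have "k \<noteq> 0"
      using p(2) y by (metis mult_1 power_0)
    then have "p ^ k > 1"
      using prime_gt_1_nat[OF p(1)] by (simp add: one_less_power del: One_nat_def)
    then have "y < m" "y > 0"
      using y(1) less.prems by auto
    then have IH: "(\<Sum>d | d dvd y. Ns a d) = (if y dvd a then of_nat y else 0)"
      by (rule less.IH)
    have "p ^ k * y dvd a \<longleftrightarrow> p ^ k dvd a \<and> y dvd a"
      using coprime by (auto intro: divides_mult dvd_mult_left dvd_mult_right)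
    then show ?thesis
      by (simp add: y(1) sum_divisors_mult_coprime[OF coprime Ns_mult_coprime] IH
          sum_divisors_prime_power[OF p(1)] sum_Ns_prime_powers[OF p(1)])
  qed
qed

section \<open>The convolution identity\<close>

theorem theorem2:
  fixes f g :: "nat \<Rightarrow> complex" and a n :: nat
  assumes g: "\<And>m. m > 0 \<Longrightarrow> g m = (\<Sum>d | d dvd m. f d)"
    and n: "n > 0"
  shows "(\<Sum>d | d dvd gcd a n. f (n div d) * of_nat d) =
         (\<Sum>d | d dvd n. Ns a d * g (n div d))"
proof -
  have fin: "finite {d. d dvd n}"
    using n by (simp add: finite_divisors_nat)
  have pos: "n div d > 0" if "d dvd n" for d
    using that n by (auto dest: dvd_imp_le simp: div_greater_zero_iff)
  have "(\<Sum>d | d dvd n. Ns a d * g (n div d)) =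
      (\<Sum>d | d dvd n. \<Sum>e | e \<in> {e. e dvd n} \<and> d * e dvd n. Ns a d * f e)"
  proof (intro sum.cong refl)
    fix d assume "d \<in> {d. d dvd n}"
    then have d: "d dvd n" "d > 0"
      using n by (auto dest: dvd_pos_nat)
    have "{e. e dvd n div d} = {e. e \<in> {e. e dvd n} \<and> d * e dvd n}"
      using d by (auto simp: dvd_div_iff_mult mult.commute dest: dvd_mult_left)
    then show "Ns a d * g (n div d) = (\<Sum>e | e \<in> {e. e dvd n} \<and> d * e dvd n. Ns a d * f e)"
      using g[OF pos[OF d(1)]] by (simp add: sum_distrib_left)
  qed
  also have "\<dots> = (\<Sum>e | e dvd n. \<Sum>d | d \<in> {d. d dvd n} \<and> d * e dvd n. Ns a d * f e)"
    using fin by (intro sum.swap_restrict) auto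
  also have "\<dots> = (\<Sum>e | e dvd n. f e * (if n div e dvd a then of_nat (n div e) else 0))"
  proof (intro sum.cong refl)
    fix e assume "e \<in> {e. e dvd n}"
    then have e: "e dvd n" "e > 0"
      using n by (auto dest: dvd_pos_nat)
    have "{d. d \<in> {d. d dvd n} \<and> d * e dvd n} = {d. d dvd n div e}"
      using e by (auto simp: dvd_div_iff_mult dest: dvd_mult_left)
    then show "(\<Sum>d | d \<in> {d. d dvd n} \<and> d * e dvd n. Ns a d * f e) =
        f e * (if n div e dvd a then of_nat (n div e) else 0)"
      using sum_divisors_Ns[OF pos[OF e(1)], of a]
      by (simp add: sum_distrib_left[symmetric] mult.commute[of _ "f e"])
  qed
  also have "\<dots> = (\<Sum>d | d dvd n. f (n div d) * (if d dvd a then of_nat d else 0))"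
    using n by (intro sum.reindex_bij_witness[of _ "\<lambda>d. n div d" "\<lambda>e. n div e"])
      (auto simp: div_div_eq_right)
  also have "\<dots> = (\<Sum>d | d dvd gcd a n. f (n div d) * of_nat d)"
    using fin by (intro sum.mono_neutral_cong_right) auto
  finally show ?thesis
    by simp
qed

end
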